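(* Let $H$ be a Hilbert space and let $A \in \mathcal{B}(H)$ be a supraposinormal operator with $AQA^* = A^*PA$, where $P, Q \in \mathcal{B}(H)$ are positive operators, at least one of which has dense range. If \[ Q \geq I \geq P \geq 0, \] then $A$ is hyponormal.
   Context: $\mathcal{B}(H)$ denotes the set of bounded linear operators on $H$, $I$ is the identity operator, and $\geq$ is the usual order on self-adjoint operators ($S \geq T$ iff $S - T$ is positive semidefinite). An operator $A \in \mathcal{B}(H)$ is supraposinormal if there exist positive (i.e. positive semidefinite) operators $P, Q \in \mathcal{B}(H)$ such that $AQA^* = A^*PA$, where at least one of $P$, $Q$ has dense range. An operator $A \in \mathcal{B}(H)$ is hyponormal if $\langle (A^*A - AA^* )f, f\rangle \geq 0$ for all $f \in H$. *)

theory Defs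
  imports "HOL-Analysis.Analysis" "HOL-Library.Complex_Order"
begin

(* Complex Hilbert spaces.  The library only has real inner product spaces.  The inner product is
   linear in its first argument, and the norm is the one it induces.  The order 0 \<le> z on complex
   numbers is that of Complex_Order: z is real and nonnegative. *)

class complex_inner = real_normed_vector +
  fixes scaleC :: "complex \<Rightarrow> 'a \<Rightarrow> 'a" (infixr "*\<^sub>C" 75)
    and cinner :: "'a \<Rightarrow> 'a \<Rightarrow> complex"
  assumes scaleC_add_right: "c *\<^sub>C (x + y) = c *\<^sub>C x + c *\<^sub>C y"
    and scaleC_add_left: "(c + d) *\<^sub>C x = c *\<^sub>C x + d *\<^sub>C x"
    and scaleC_scaleC: "c *\<^sub>C (d *\<^sub>C x) = (c * d) *\<^sub>C x"
    and scaleR_scaleC: "scaleR r x = complex_of_real r *\<^sub>C x"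
    and cinner_add_left: "cinner (x + y) z = cinner x z + cinner y z"
    and cinner_scaleC_left: "cinner (c *\<^sub>C x) y = c * cinner x y"
    and cinner_commute: "cinner y x = cnj (cinner x y)"
    and cinner_ge_zero: "0 \<le> cinner x x"
    and cinner_eq_zero_iff: "cinner x x = 0 \<longleftrightarrow> x = 0"
    and norm_eq_sqrt_cinner: "norm x = sqrt (Re (cinner x x))"

class chilbert_space = complex_inner + complete_space

instantiation complex :: chilbert_space
begin

definition scaleC_complex :: "complex \<Rightarrow> complex \<Rightarrow> complex" where
  "scaleC_complex c x = c * x"

definition cinner_complex :: "complex \<Rightarrow> complex \<Rightarrow> complex" where
  "cinner_complex x y = x * cnj y"

instance
proof
  fix x :: complex
  show "norm x = sqrt (Re (cinner x x))"
    by (simp add: cinner_complex_def cmod_def power2_eq_square)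
  show "0 \<le> cinner x x"
    by (simp add: cinner_complex_def less_eq_complex_def)
qed (simp_all add: scaleC_complex_def cinner_complex_def scaleR_conv_of_real algebra_simps)

end

definition bounded_clinear :: "('a::complex_inner \<Rightarrow> 'a) \<Rightarrow> bool" where
  "bounded_clinear A \<longleftrightarrow> bounded_linear A \<and> (\<forall>c x. A (c *\<^sub>C x) = c *\<^sub>C A x)"

(* Uniqueness holds by nondegeneracy of the inner product; for a bounded operator on a Hilbert
   space, existence is the Riesz representation theorem. *)
definition cadjoint :: "('a::chilbert_space \<Rightarrow> 'a) \<Rightarrow> 'a \<Rightarrow> 'a" where
  "cadjoint A = (THE B. \<forall>x y. cinner (A x) y = cinner x (B y))"

(* On a complex space the condition makes T self-adjoint. *)
definition positive_op :: "('a::chilbert_space \<Rightarrow> 'a) \<Rightarrow> bool" where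
  "positive_op T \<longleftrightarrow> bounded_clinear T \<and> (\<forall>f. 0 \<le> cinner (T f) f)"

definition op_ge :: "('a::chilbert_space \<Rightarrow> 'a) \<Rightarrow> ('a \<Rightarrow> 'a) \<Rightarrow> bool" where
  "op_ge S T \<longleftrightarrow> positive_op (\<lambda>f. S f - T f)"

definition dense_range :: "('a::chilbert_space \<Rightarrow> 'a) \<Rightarrow> bool" where
  "dense_range T \<longleftrightarrow> closure (range T) = UNIV"

definition supraposinormal_via ::
    "('a::chilbert_space \<Rightarrow> 'a) \<Rightarrow> ('a \<Rightarrow> 'a) \<Rightarrow> ('a \<Rightarrow> 'a) \<Rightarrow> bool" where
  "supraposinormal_via A P Q \<longleftrightarrow> positive_op P \<and> positive_op Q \<and>
     A \<circ> Q \<circ> cadjoint A = cadjoint A \<circ> P \<circ> A \<and> (dense_range P \<or> dense_range Q)"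

definition supraposinormal :: "('a::chilbert_space \<Rightarrow> 'a) \<Rightarrow> bool" where
  "supraposinormal A \<longleftrightarrow> bounded_clinear A \<and> (\<exists>P Q. supraposinormal_via A P Q)"

definition hyponormal :: "('a::chilbert_space \<Rightarrow> 'a) \<Rightarrow> bool" where
  "hyponormal A \<longleftrightarrow> bounded_clinear A \<and>
     (\<forall>f. 0 \<le> cinner ((cadjoint A \<circ> A) f - (A \<circ> cadjoint A) f) f)"

end

(* With A* the adjoint of A,
     <A A* f, f> = <A* f, A* f> \<le> <Q A* f, A* f> = <P A f, A f> \<le> <A f, A f> = <A* A f, f>.
   That the adjoint exists is the Riesz representation theorem.  For a bounded real-linear
   functional g the representing vector is twice the minimiser of |x|^2 - g x; minimising sequences
   are Cauchy by the parallelogram law. *)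

theory Submission
  imports Defs
begin

text \<open>The real part of \<open>cinner\<close> is a real inner product inducing the same norm,
  so Cauchy-Schwarz and the real inner product calculus become available.\<close>

interpretation Re_cinner: real_inner
  minus dist norm plus 0 uminus scaleR sgn uniformity "open"
  "\<lambda>x y :: 'a::complex_inner. Re (cinner x y)"
proof
  fix x y z :: 'a and r :: real
  show "Re (cinner x y) = Re (cinner y x)"
    by (metis cinner_commute cnj.sel(1))
  show "Re (cinner (x + y) z) = Re (cinner x z) + Re (cinner y z)"
    by (simp add: cinner_add_left)
  show "Re (cinner (r *\<^sub>R x) y) = r * Re (cinner x y)"
    by (simp add: scaleR_scaleC cinner_scaleC_left)
  show "0 \<le> Re (cinner x x)"
    using cinner_ge_zero[of x] by (simp add: less_eq_complex_def)
  show "Re (cinner x x) = 0 \<longleftrightarrow> x = 0"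
    using cinner_ge_zero[of x] cinner_eq_zero_iff[of x]
    by (auto simp: less_eq_complex_def complex_eq_iff)
  show "norm x = sqrt (Re (cinner x x))"
    by (rule norm_eq_sqrt_cinner)
qed

lemmas Re_cinner_simps =
  Re_cinner.inner_add_left Re_cinner.inner_add_right
  Re_cinner.inner_diff_left Re_cinner.inner_diff_right
  Re_cinner.inner_scaleR_left Re_cinner.inner_scaleR_right

lemma bounded_linear_Re_cinner_left:
  "bounded_linear (\<lambda>x::'a::complex_inner. Re (cinner x y))"
  by (rule bounded_linear_intro[where K = "norm y"])
    (use Re_cinner.Cauchy_Schwarz_ineq2[of _ y] in
      \<open>simp_all add: Re_cinner.inner_add_left Re_cinner.inner_scaleR_left\<close>)

lemma Re_cinner_Riesz:
  fixes g :: "'a::chilbert_space \<Rightarrow> real"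
  assumes "bounded_linear g"
  shows "\<exists>z. \<forall>x. g x = Re (cinner x z)"
proof -
  interpret g: bounded_linear g by fact
  define J where "J = (\<lambda>x. (norm x)\<^sup>2 - g x)"
  have norm_eq: "(norm x)\<^sup>2 = Re (cinner x x)" for x :: 'a
    by (simp add: Re_cinner.power2_norm_eq_inner)
  obtain K where K: "\<And>x. norm (g x) \<le> norm x * K"
    using g.bounded by blast
  \<comment> \<open>Completing the square: \<open>J x\<close> is at least
    \<open>(norm x)\<^sup>2 - K * norm x\<close>, which is
    \<open>(norm x - K / 2)\<^sup>2 - K\<^sup>2 / 4\<close>.\<close>
  have "- (K\<^sup>2) / 4 \<le> J x" for x
    using K[of x] zero_le_power2[of "norm x - K / 2"]
    by (simp add: J_def power2_diff power_divide algebra_simps abs_le_iff)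
  then have bdd: "bdd_below (range J)"
    by (metis bdd_belowI2)
  define m where "m = Inf (range J)"
  have m_le: "m \<le> J x" for x
    unfolding m_def using bdd by (simp add: cINF_lower)
  \<comment> \<open>Parallelogram law at the midpoint \<open>c\<close>: the \<open>g\<close> terms
    cancel by linearity, and \<open>J c\<close> is at least \<open>m\<close>.\<close>
  have close: "(norm (x - y))\<^sup>2 \<le> 2 * (J x - m) + 2 * (J y - m)" for x y
  proof -
    define c where "c = (1/2) *\<^sub>R (x + y)"
    have "(norm (x - y))\<^sup>2 = 2 * J x + 2 * J y - 4 * J c"
      unfolding c_def
      by (simp add: J_def norm_eq g.add g.scaleR Re_cinner_simps Re_cinner.inner_commute
          algebra_simps power_mult_distrib)
    then show ?thesis
      using m_le[of c] by argo
  qed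
  have "\<exists>x. J x < m + inverse (real (Suc n))" for n
  proof -
    have "Inf (range J) < m + inverse (real (Suc n))"
      by (simp add: m_def)
    then show ?thesis
      by (subst (asm) cInf_less_iff) (use bdd in auto)
  qed
  then obtain X where X: "\<And>n. J (X n) < m + inverse (real (Suc n))"
    by metis
  have "Cauchy X"
  proof (rule CauchyI)
    fix e :: real
    assume "0 < e"
    then obtain N where N: "inverse (real (Suc N)) < e\<^sup>2 / 4"
      using reals_Archimedean[of "e\<^sup>2 / 4"] by auto
    \<comment> \<open>A quarter suffices: \<open>close\<close> doubles each of two such excesses,
      for a total below \<open>e\<^sup>2\<close>.\<close>
    have small: "J (X n) - m < e\<^sup>2 / 4" if "n \<ge> N" for n
    proof -
      have "inverse (real (Suc n)) \<le> inverse (real (Suc N))"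
        using that by (intro le_imp_inverse_le) auto
      then show ?thesis
        using X[of n] N by linarith
    qed
    have "norm (X i - X j) < e" if "i \<ge> N" "j \<ge> N" for i j
    proof (rule power2_less_imp_less)
      show "(norm (X i - X j))\<^sup>2 < e\<^sup>2"
        using close[of "X i" "X j"] small[OF that(1)] small[OF that(2)] by argo
    qed (use \<open>0 < e\<close> in simp)
    then show "\<exists>M. \<forall>i\<ge>M. \<forall>j\<ge>M. norm (X i - X j) < e"
      by blast
  qed
  then obtain w where w: "X \<longlonglongrightarrow> w"
    using Cauchy_convergent unfolding convergent_def by blast
  have "(\<lambda>n. J (X n)) \<longlonglongrightarrow> J w"
    unfolding J_def by (intro tendsto_intros g.tendsto w)
  moreover have "(\<lambda>n. m + inverse (real (Suc n))) \<longlonglongrightarrow> m"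
    using LIMSEQ_inverse_real_of_nat_add by simp
  ultimately have "J w \<le> m"
    by (rule LIMSEQ_le) (use X less_imp_le in blast)
  then have min: "J w \<le> J x" for x
    using m_le order_trans by blast
  have "g x = Re (cinner x (2 *\<^sub>R w))" for x
  proof (rule ccontr)
    \<comment> \<open>The derivative of \<open>J\<close> at \<open>w\<close> in direction
      \<open>x\<close> is \<open>- d\<close>; at a minimiser it must vanish.\<close>
    define d where "d = g x - 2 * Re (cinner x w)"
    assume "g x \<noteq> Re (cinner x (2 *\<^sub>R w))"
    then have d: "d \<noteq> 0"
      by (simp add: d_def Re_cinner_simps)
    then have "x \<noteq> 0"
      by (auto simp: d_def Re_cinner_simps)
    define s where "s = (norm x)\<^sup>2"
    have s: "s > 0"
      using \<open>x \<noteq> 0\<close> by (simp add: s_def)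
    have J_add: "J (w + t *\<^sub>R x) = J w - t * d + t\<^sup>2 * s" for t
      unfolding s_def d_def J_def norm_eq
      by (simp add: g.add g.scaleR Re_cinner_simps Re_cinner.inner_commute[of w x]
          power2_eq_square algebra_simps)
    have "t * d \<le> t\<^sup>2 * s" for t
      using min[of "w + t *\<^sub>R x"] by (simp add: J_add)
    \<comment> \<open>This \<open>t\<close> minimises \<open>t\<^sup>2 * s - t * d\<close>, whose
      value there is \<open>- (d\<^sup>2) / (4 * s)\<close>.\<close>
    from this[of "d / (2 * s)"] have "d\<^sup>2 \<le> 0"
      using s by (simp add: field_simps power2_eq_square)
    with d show False
      by simp
  qed
  then show ?thesis
    by blast
qed

text \<open>Since \<open>Re (\<i> * z)\<close> is \<open>- Im z\<close>, an identity of real parts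
  that survives multiplication by \<open>\<i>\<close> is an identity of complex numbers.\<close>

lemma complex_eq_if_Re_eq_Re_ii:
  "Re z = Re w \<Longrightarrow> Re (\<i> * z) = Re (\<i> * w) \<Longrightarrow> z = w"
  by (simp add: complex_eq_iff)

lemma cinner_eqI:
  fixes y z :: "'a::complex_inner"
  assumes "\<And>x. cinner x y = cinner x z"
  shows "y = z"
proof -
  have "Re (cinner (y - z) (y - z)) = 0"
    using assms[of "y - z"] by (simp add: Re_cinner.inner_diff_right)
  then show ?thesis
    by (simp add: Re_cinner.inner_eq_zero_iff)
qed

text \<open>Justifies the definite description in \<open>cadjoint\<close>: Riesz gives existence,
  first for real parts only, and nondegeneracy (\<open>cinner_eqI\<close>) gives uniqueness.\<close>

lemma cadjoint_cinner:
  fixes A :: "'a::chilbert_space \<Rightarrow> 'a"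
  assumes "bounded_clinear A"
  shows "cinner (A x) y = cinner x (cadjoint A y)"
proof -
  have A: "bounded_linear A" "\<And>c x. A (c *\<^sub>C x) = c *\<^sub>C A x"
    using assms by (auto simp: bounded_clinear_def)
  have "\<exists>z. \<forall>x. Re (cinner (A x) y) = Re (cinner x z)" for y
    using bounded_linear_compose[OF bounded_linear_Re_cinner_left A(1)]
    by (rule Re_cinner_Riesz)
  then obtain B where B: "\<And>x y. Re (cinner (A x) y) = Re (cinner x (B y))"
    by metis
  \<comment> \<open>Complex linearity of \<open>A\<close> moves the factor \<open>\<i>\<close> into
    \<open>x\<close>, so the real-part identity \<open>B\<close> at \<open>\<i> *\<^sub>C x\<close>
    settles the imaginary parts.\<close>
  have adj: "cinner (A x) y = cinner x (B y)" for x y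
    by (rule complex_eq_if_Re_eq_Re_ii)
      (simp_all only: B A(2)[symmetric] cinner_scaleC_left[symmetric])
  have "cadjoint A = B"
    unfolding cadjoint_def
  proof (rule the_equality)
    fix B' assume "\<forall>x y. cinner (A x) y = cinner x (B' y)"
    then show "B' = B"
      by (metis adj cinner_eqI ext)
  qed (use adj in blast)
  then show ?thesis
    by (simp add: adj)
qed

lemma op_ge_Re_cinner:
  assumes "op_ge S T"
  shows "Re (cinner (T f) f) \<le> Re (cinner (S f) f)"
proof -
  have "0 \<le> Re (cinner (S f - T f) f)"
    using assms by (simp add: op_ge_def positive_op_def less_eq_complex_def)
  then show ?thesis
    by (simp add: Re_cinner.inner_diff_left)
qed

theorem theorem1p1:
  fixes A P Q :: "'a::chilbert_space \<Rightarrow> 'a"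
  assumes "supraposinormal A"
    and "positive_op P" and "positive_op Q"
    and "A \<circ> Q \<circ> cadjoint A = cadjoint A \<circ> P \<circ> A"
    and "dense_range P \<or> dense_range Q"
    and "op_ge Q id" and "op_ge id P" and "op_ge P (\<lambda>f. 0)"
  shows "hyponormal A"
proof -
  have A: "bounded_clinear A"
    using assms(1) by (simp add: supraposinormal_def)
  note adj = cadjoint_cinner[OF A]
  have adj': "cinner (cadjoint A x) y = cinner x (A y)" for x y
    by (metis adj cinner_commute)
  have "0 \<le> cinner ((cadjoint A \<circ> A) f - (A \<circ> cadjoint A) f) f" for f
  proof -
    let ?g = "cadjoint A f"
    have "Re (cinner ?g ?g) \<le> Re (cinner (Q ?g) ?g)"
      using op_ge_Re_cinner[OF assms(6)] by simp
    also have "cinner (Q ?g) ?g = cinner (A (Q ?g)) f"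
      by (simp add: adj)
    also have "A (Q ?g) = cadjoint A (P (A f))"
      using fun_cong[OF assms(4), of f] by simp
    also have "cinner \<dots> f = cinner (P (A f)) (A f)"
      by (rule adj')
    also have "Re \<dots> \<le> Re (cinner (A f) (A f))"
      using op_ge_Re_cinner[OF assms(7)] by simp
    finally have le: "Re (cinner ?g ?g) \<le> Re (cinner (A f) (A f))" .
    \<comment> \<open>Additivity in the first argument, with \<open>A ?g\<close> added back, splits
      the inner product of the difference.\<close>
    have "cinner (cadjoint A (A f) - A ?g) f + cinner (A ?g) f = cinner (cadjoint A (A f)) f"
      by (simp flip: cinner_add_left)
    then have "cinner (cadjoint A (A f) - A ?g) f = cinner (A f) (A f) - cinner ?g ?g"
      by (simp add: adj adj' algebra_simps)
    \<comment> \<open>Both \<open>cinner (A f) (A f)\<close> and \<open>cinner ?g ?g\<close> are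
      real, so the complex order reduces to the real inequality \<open>le\<close>.\<close>
    then show ?thesis
      using le cinner_ge_zero[of "A f"] cinner_ge_zero[of ?g]
      by (simp add: less_eq_complex_def)
  qed
  with A show ?thesis
    by (simp add: hyponormal_def)
qed

end
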